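(* Let $G$ be a finite simple graph with $|G|$ vertices and maximum degree $\Delta(G)$. If $\frac{2}{3}|G|-1>\Delta(G)\geq \frac{2}{3}|G|-2$, then $a_{eq}(G)\leq \left\lceil\frac{\Delta(G)+1}{2}\right\rceil$.
   Context: All graphs are finite, undirected, without loops or multiple edges; $|G|$ denotes the number of vertices of $G$. A graph $G$ admits an equitable $k$-tree-coloring if $V(G)$ can be partitioned into $k$ subsets, each of size $\lceil |G|/k\rceil$ or $\lfloor |G|/k\rfloor$, such that each subset induces a forest in $G$. The equitable vertex arboricity $a_{eq}(G)$ is the minimum integer $k$ such that $G$ has an equitable $k$-tree-coloring. *)

theory Defs
  imports Complex_Main "Graph_Theory.Graph_Theory" "HOL-Library.Disjoint_Sets"
begin

text \<open>
  Finite simple graphs are elements of the locale \<^locale>\<open>graph\<close>: an undirected edge \<open>uv\<close> is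
  represented by the two arcs \<open>(u,v)\<close> and \<open>(v,u)\<close>, so \<^const>\<open>out_degree\<close> is the degree.
\<close>

definition max_degree :: "('a, 'b) pre_digraph \<Rightarrow> nat" where
  "max_degree G = Max (out_degree G ` verts G)"

text \<open>
  The library's \<^const>\<open>forest\<close> is a notion for directed graphs: in a symmetric digraph every edge
  yields the closed walk \<open>u, v, u\<close>, which counts as a \<^const>\<open>pre_digraph.cycle\<close>. The cycles of the
  underlying undirected simple graph are those of length at least 3.
\<close>

definition undirected_forest :: "('a, 'b) pre_digraph \<Rightarrow> bool" where
  "undirected_forest G \<longleftrightarrow> \<not> (\<exists>p. pre_digraph.cycle G p \<and> 3 \<le> length p)"

text \<open>
  The parts \<open>P 0, \<dots>, P (k - 1)\<close> are indexed, so that for \<open>k > |G|\<close>, where the floor is 0,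
  several of them may be empty.
\<close>

definition equitable_tree_coloring :: "('a, 'b) pre_digraph \<Rightarrow> nat \<Rightarrow> (nat \<Rightarrow> 'a set) \<Rightarrow> bool" where
  "equitable_tree_coloring G k P \<longleftrightarrow>
     (\<Union>i<k. P i) = verts G \<and> disjoint_family_on P {..<k} \<and>
     (\<forall>i<k. int (card (P i)) = \<lceil>real (card (verts G)) / real k\<rceil> \<or>
            int (card (P i)) = \<lfloor>real (card (verts G)) / real k\<rfloor>) \<and>
     (\<forall>i<k. undirected_forest (G \<restriction> P i))"

definition equitable_vertex_arboricity :: "('a, 'b) pre_digraph \<Rightarrow> nat" where
  "equitable_vertex_arboricity G = (LEAST k. 0 < k \<and> (\<exists>P. equitable_tree_coloring G k P))"

end

theory Submission
  imports Defs
begin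

text \<open>
  Write \<open>n = |G|\<close> and \<open>k\<close> for the claimed bound. The hypotheses leave only \<open>n = 3k - 1\<close> and \<open>n = 3k\<close>,
  both with \<open>\<Delta> = 2k - 2\<close>, and \<open>n = 3k + 1\<close> with \<open>\<Delta> = 2k - 1\<close>. Three vertices induce a forest as soon as
  two of them are nonadjacent, so in the first two cases it suffices to extend a matching of size
  \<open>k\<close> in the complement, which exists because the complement has minimum degree at least \<open>k\<close>. In the
  last case the complement has a matching of size \<open>k + 1\<close>. The \<open>k - 1\<close> unmatched vertices are too few for
  the degree \<open>k + 1\<close> of a matched vertex, so two matching edges are joined in the complement; they
  form a path on four vertices, whose complement is again a path, and this is the class of size 4.
\<close>

section \<open>Matchings under a minimum degree condition\<close>

definition is_matching :: "'a set \<Rightarrow> ('a \<Rightarrow> 'a \<Rightarrow> bool) \<Rightarrow> nat \<Rightarrow> (nat \<Rightarrow> 'a set) \<Rightarrow> bool" where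
  "is_matching V H m P \<longleftrightarrow> disjoint_family_on P {..<m} \<and>
     (\<forall>i<m. \<exists>x\<in>V. \<exists>y\<in>V. P i = {x, y} \<and> H x y)"

lemma disjoint_family_on_lessThanD:
  assumes "disjoint_family_on P {..<k}" "i < k" "j < k" "x \<in> P i" "x \<in> P j"
  shows "i = j"
  using assms unfolding disjoint_family_on_def by auto

lemma disjoint_family_on_fun_upd:
  assumes "disjoint_family_on P I" "\<And>j. j \<in> I \<Longrightarrow> j \<noteq> i \<Longrightarrow> P j \<inter> R = {}"
  shows "disjoint_family_on (P(i := R)) (insert i I)"
  using assms unfolding disjoint_family_on_def by (auto simp: disjoint_iff)

text \<open>Augmentation, by induction on \<open>m\<close>: if no edge joins two unmatched vertices,
  then two unmatched vertices \<open>u\<close> and \<open>v\<close> send all their edges into the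
  matching, and some matching edge can be exchanged for two new ones.\<close>

lemma ex_matching:
  fixes H :: "'a \<Rightarrow> 'a \<Rightarrow> bool"
  assumes fin: "finite V" and sym: "\<And>u v. H u v \<Longrightarrow> H v u" and irrefl: "\<And>v. \<not> H v v"
    and deg: "\<And>v. v \<in> V \<Longrightarrow> d \<le> card {w \<in> V. H v w}"
    and "2 * d \<le> card V" "m \<le> d"
  shows "\<exists>P. is_matching V H m P"
  using \<open>m \<le> d\<close>
proof (induction m)
  case 0
  show ?case by (auto simp: is_matching_def disjoint_family_on_def)
next
  case (Suc m)
  then obtain P where P: "is_matching V H m P" by auto
  then have disj: "disjoint_family_on P {..<m}"
    and edge: "\<And>i. i < m \<Longrightarrow> \<exists>x\<in>V. \<exists>y\<in>V. P i = {x, y} \<and> H x y"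
    by (auto simp: is_matching_def)
  define U where "U = (\<Union>i<m. P i)"
  have card2: "card (P i) \<le> 2" if "i < m" for i
    using edge[OF that] by (auto simp: card_insert_if)
  have "card U \<le> (\<Sum>i<m. card (P i))"
    unfolding U_def by (rule card_UN_le) simp
  also have "\<dots> \<le> (\<Sum>i<m. 2)" using card2 by (intro sum_mono) auto
  finally have "card U \<le> 2 * m" by simp
  have UV: "U \<subseteq> V" using edge unfolding U_def by fastforce
  then have "card (V - U) = card V - card U"
    using fin by (simp add: card_Diff_subset finite_subset)
  then have "2 \<le> card (V - U)"
    using \<open>card U \<le> 2 * m\<close> assms(5) Suc.prems by linarith
  then obtain T where "T \<subseteq> V - U" "card T = 2" by (meson obtain_subset_with_card_n)
  then obtain u v where uv: "u \<in> V - U" "v \<in> V - U" "u \<noteq> v"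
    by (auto simp: card_2_iff)
  show ?case
  proof (cases "\<exists>a\<in>V-U. \<exists>b\<in>V-U. H a b")
    case True
    then obtain a b where ab: "a \<in> V - U" "b \<in> V - U" "H a b" by blast
    have "disjoint_family_on (P(m := {a, b})) {..<Suc m}"
      unfolding lessThan_Suc using ab disj
      by (intro disjoint_family_on_fun_upd) (auto simp: U_def)
    then have "is_matching V H (Suc m) (P(m := {a, b}))"
      using ab edge unfolding is_matching_def by (auto simp: less_Suc_eq)
    then show ?thesis by blast
  next
    case False
    define N where "N z = {w \<in> V. H z w}" for z
    have NU: "card (N z) \<le> (\<Sum>i<m. card (N z \<inter> P i))" if "z \<in> V - U" for z
    proof -
      have "N z = (\<Union>i<m. N z \<inter> P i)"
        using False that unfolding N_def U_def by blast
      then show ?thesis using card_UN_le[of "{..<m}" "\<lambda>i. N z \<inter> P i"] by simp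
    qed
    \<comment> \<open>Pigeonhole: otherwise the \<open>m\<close> matching edges absorb at most
      \<open>2 * m\<close> of the at least \<open>2 * d\<close> edge ends counted at
      \<open>u\<close> and \<open>v\<close>, although \<open>m < d\<close>.\<close>
    have "\<exists>i<m. 2 < card (N u \<inter> P i) + card (N v \<inter> P i)"
    proof (rule ccontr)
      assume "\<not> ?thesis"
      then have "(\<Sum>i<m. card (N u \<inter> P i) + card (N v \<inter> P i)) \<le> (\<Sum>i<m. 2)"
        by (intro sum_mono) (metis lessThan_iff not_less)
      then have "card (N u) + card (N v) \<le> 2 * m"
        using NU[OF uv(1)] NU[OF uv(2)] by (simp add: sum.distrib)
      moreover have "d \<le> card (N u)" "d \<le> card (N v)"
        using deg uv by (auto simp: N_def)
      ultimately show False using Suc.prems by linarith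
    qed
    then obtain i where i: "i < m" "2 < card (N u \<inter> P i) + card (N v \<inter> P i)" by blast
    obtain x y where xy: "x \<in> V" "y \<in> V" "P i = {x, y}" "H x y" using edge[OF i(1)] by blast
    have cardN: "card (N z \<inter> P i) = of_bool (H z x) + of_bool (H z y)" for z
      using xy irrefl[of x] unfolding N_def by (cases "x = y") (auto simp: Int_insert_right)
    \<comment> \<open>Hence \<open>u, v\<close> can be matched to different ends of the edge \<open>xy\<close>, which augments the matching.\<close>
    have "(H u x \<and> H v y) \<or> (H u y \<and> H v x)"
      using i(2) unfolding cardN of_bool_def by (auto split: if_splits)
    then obtain a b where ab: "P i = {a, b}" "H u a" "H v b" "a \<in> V" "b \<in> V" "a \<noteq> b"
      using xy irrefl by (metis insert_commute)
    \<comment> \<open>\<open>{u, a}\<close> replaces the edge at index \<open>i\<close>, and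
      \<open>{v, b}\<close> takes the new index \<open>m\<close>. The facts collected here keep both
      disjoint from the other edges and from each other.\<close>
    have "a \<notin> P j \<and> b \<notin> P j" if "j < m" "j \<noteq> i" for j
      using disjoint_family_on_lessThanD[OF disj] ab(1) that i(1) by blast
    moreover have "u \<notin> P j \<and> v \<notin> P j" if "j < m" for j
      using uv that unfolding U_def by auto
    moreover have "v \<noteq> a" "u \<noteq> b"
      using uv ab(1) i(1) unfolding U_def by auto
    moreover have "{..<Suc m} = insert m (insert i {..<m})" using i(1) by auto
    ultimately have "disjoint_family_on (P(i := {u, a}, m := {v, b})) {..<Suc m}"
      using ab uv i(1) by (auto intro!: disjoint_family_on_fun_upd disj split: if_splits)
    then have "is_matching V H (Suc m) (P(i := {u, a}, m := {v, b}))"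
      using ab uv edge unfolding is_matching_def by (auto simp: less_Suc_eq)
    then show ?thesis by blast
  qed
qed

section \<open>Partitions with prescribed seeds and class sizes\<close>

text \<open>The last class is filled first, using only vertices outside the other seeds. The
  remaining classes must then partition what is left, so the induction generalises over
  \<open>V\<close>.\<close>

lemma ex_partition_extending:
  fixes P :: "nat \<Rightarrow> 'a set" and t :: "nat \<Rightarrow> nat"
  assumes "finite V" "disjoint_family_on P {..<k}"
    and "\<And>i. i < k \<Longrightarrow> P i \<subseteq> V" "\<And>i. i < k \<Longrightarrow> card (P i) \<le> t i"
    and "(\<Sum>i<k. t i) = card V"
  shows "\<exists>Q. disjoint_family_on Q {..<k} \<and> (\<Union>i<k. Q i) = V \<and>
    (\<forall>i<k. P i \<subseteq> Q i \<and> card (Q i) = t i)"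
  using assms
proof (induction k arbitrary: V)
  case 0
  then show ?case by (auto simp: disjoint_family_on_def)
next
  case (Suc k)
  define W where "W = V - (\<Union>i<k. P i)"
  have "P k \<inter> P i = {}" if "i < k" for i
    using Suc.prems(2) that by (simp add: disjoint_family_on_def)
  then have PkW: "P k \<subseteq> W"
    using Suc.prems(3)[of k] unfolding W_def by blast
  have PV: "(\<Union>i<k. P i) \<subseteq> V"
    using Suc.prems(3) by (intro UN_least) simp
  have "card (\<Union>i<k. P i) \<le> (\<Sum>i<k. card (P i))" by (rule card_UN_le) simp
  also have "\<dots> \<le> (\<Sum>i<k. t i)" using Suc.prems(4) by (intro sum_mono) auto
  \<comment> \<open>The other seeds occupy no more than their target sizes, so at least
    \<open>t k\<close> vertices remain in \<open>W\<close>.\<close>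
  finally have "card (\<Union>i<k. P i) + t k \<le> card V" using Suc.prems(5) by simp
  moreover have "card W = card V - card (\<Union>i<k. P i)"
    unfolding W_def using finite_subset[OF PV Suc.prems(1)] PV by (rule card_Diff_subset)
  ultimately have "t k \<le> card W" by simp
  then obtain R where R: "P k \<subseteq> R" "R \<subseteq> W" "card R = t k"
    using exists_subset_between[of "P k" "t k" W] PkW Suc.prems(1) Suc.prems(4)[of k]
    unfolding W_def by auto
  have RV: "R \<subseteq> V" using R(2) unfolding W_def by blast
  have "\<exists>Q. disjoint_family_on Q {..<k} \<and> (\<Union>i<k. Q i) = V - R \<and>
    (\<forall>i<k. P i \<subseteq> Q i \<and> card (Q i) = t i)"
  proof (rule Suc.IH)
    show "disjoint_family_on P {..<k}"
      using Suc.prems(2) by (auto simp: disjoint_family_on_def)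
    show "P i \<subseteq> V - R" if "i < k" for i
      using that Suc.prems(3)[of i] R(2) unfolding W_def by auto
    show "(\<Sum>i<k. t i) = card (V - R)"
      using Suc.prems(1,5) R(3) RV by (simp add: card_Diff_subset finite_subset)
  qed (use Suc.prems in auto)
  then obtain Q where Q: "disjoint_family_on Q {..<k}" "(\<Union>i<k. Q i) = V - R"
    "\<forall>i<k. P i \<subseteq> Q i \<and> card (Q i) = t i" by blast
  have QR: "Q i \<inter> R = {}" if "i < k" for i using Q(2) that by blast
  have "disjoint_family_on (Q(k := R)) {..<Suc k}"
    unfolding lessThan_Suc using Q(1) QR by (intro disjoint_family_on_fun_upd) auto
  moreover have "(\<Union>i<Suc k. (Q(k := R)) i) = V"
    using Q(2) RV by (auto simp: lessThan_Suc)
  moreover have "\<forall>i<Suc k. P i \<subseteq> (Q(k := R)) i \<and> card ((Q(k := R)) i) = t i"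
    using Q(3) R by (auto simp: less_Suc_eq)
  ultimately show ?case by blast
qed

section \<open>From cycles to vertex sets\<close>

lemma (in pre_digraph) cas_nth:
  assumes "cas u p v" "Suc i < length p"
  shows "tail G (p ! Suc i) = head G (p ! i)"
  using assms
proof (induction p arbitrary: u i)
  case (Cons e p)
  then show ?case by (cases i; cases p) auto
qed simp

lemma (in pre_digraph) awalk_verts_heads:
  assumes "cas u p v"
  shows "awalk_verts u p = u # map (head G) p"
  using assms by (induction u p v rule: cas.induct) auto

lemma (in pre_digraph) cas_head_last:
  assumes "cas u p v" "p \<noteq> []"
  shows "head G (last p) = v"
  using assms by (induction u p v rule: cas.induct) auto

text \<open>\<open>C\<close> is the vertex set of the cycle, with predecessor \<open>a\<close> and
  successor \<open>b\<close> of \<open>v\<close>; these differ because the length is at least 3.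
  Acyclicity can then be proved without handling walks.\<close>

lemma (in pre_digraph) cycle_core:
  assumes "cycle p" "3 \<le> length p"
  obtains C where "C \<noteq> {}"
    "\<And>v. v \<in> C \<Longrightarrow> \<exists>a\<in>C. \<exists>b\<in>C. a \<noteq> b \<and> (a, v) \<in> arcs_ends G \<and> (v, b) \<in> arcs_ends G"
proof -
  obtain u where u: "cas u p u" "set p \<subseteq> arcs G" "distinct (tl (awalk_verts u p))" "p \<noteq> []"
    using assms(1) unfolding cycle_def awalk_def by blast
  define L where "L = length p"
  define h where "h i = head G (p ! i)" for i
  \<comment> \<open>\<open>awalk_verts\<close> lists \<open>u\<close> followed by the heads of the
    arcs, so its tail is exactly the list of heads. Hence \<open>h\<close> enumerates the vertices
    of the cycle without repetition.\<close>
  have dist: "distinct (map (head G) p)"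
    using u by (simp add: awalk_verts_heads)
  have inj: "h i \<noteq> h j" if "i < L" "j < L" "i \<noteq> j" for i j
    using dist that nth_eq_iff_index_eq[OF dist, of i j] unfolding h_def L_def by auto
  have "tail G (p ! 0) = u" using u by (cases p) auto
  moreover have "head G (last p) = u"
    using cas_head_last[OF u(1,4)] .
  ultimately have t0: "tail G (p ! 0) = h (L - 1)"
    using u(4) by (simp add: h_def L_def last_conv_nth)
  have tS: "tail G (p ! Suc i) = h i" if "Suc i < L" for i
    using cas_nth[OF u(1)] that by (simp add: h_def L_def)
  have ends: "(tail G (p ! i), h i) \<in> arcs_ends G" if "i < L" for i
    using that u(2) nth_mem[of i p] unfolding arcs_ends_conv h_def L_def
    by (intro image_eqI[of _ _ "p ! i"]) auto
  have stepS: "(h i, h (Suc i)) \<in> arcs_ends G" if "Suc i < L" for i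
    using ends[OF that] tS[OF that] by simp
  have L3: "3 \<le> L" using assms(2) by (simp add: L_def)
  have step0: "(h (L - 1), h 0) \<in> arcs_ends G"
    using ends[of 0] L3 unfolding t0 by simp
  show thesis
  proof (rule that)
    have "0 \<in> {..<L}" using L3 by simp
    then show "h ` {..<L} \<noteq> {}" by blast
    fix v assume "v \<in> h ` {..<L}"
    then obtain i where i: "i < L" "v = h i" by auto
    \<comment> \<open>Predecessor and successor of \<open>i\<close> modulo \<open>L\<close>.\<close>
    define a where "a = (if i = 0 then L - 1 else i - 1)"
    define b where "b = (if Suc i = L then 0 else Suc i)"
    have "a < L" "b < L" "a \<noteq> b" using i L3 unfolding a_def b_def by auto
    moreover have "(h a, h i) \<in> arcs_ends G"
      using step0 stepS[of "i - 1"] i unfolding a_def by (cases i) auto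
    moreover have "(h i, h b) \<in> arcs_ends G"
      using step0 stepS[of i] i unfolding b_def by auto
    ultimately show "\<exists>a\<in>h ` {..<L}. \<exists>b\<in>h ` {..<L}. a \<noteq> b \<and>
        (a, v) \<in> arcs_ends G \<and> (v, b) \<in> arcs_ends G"
      using inj i(2) by (meson imageI lessThan_iff)
  qed
qed

section \<open>Induced forests on three and four vertices\<close>

context graph
begin

text \<open>Apply \<open>cycle_core\<close> to the induced subgraph; the absence of loops separates
  \<open>v\<close> from its two neighbours. In applications, vertices with fewer than two possible
  neighbours are removed from \<open>C\<close> until nothing is left.\<close>

lemma undirected_forest_induceI:
  assumes "\<And>C. \<lbrakk>C \<subseteq> S; \<And>v. v \<in> C \<Longrightarrow> \<exists>a\<in>C. \<exists>b\<in>C. a \<noteq> b \<and> a \<noteq> v \<and> b \<noteq> v \<and>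
      (a, v) \<in> arcs_ends G \<and> (v, b) \<in> arcs_ends G\<rbrakk> \<Longrightarrow> C = {}"
  shows "undirected_forest (G \<restriction> S)"
  unfolding undirected_forest_def
proof
  assume "\<exists>p. pre_digraph.cycle (G \<restriction> S) p \<and> 3 \<le> length p"
  then obtain p where "pre_digraph.cycle (G \<restriction> S) p" "3 \<le> length p" by blast
  then obtain C where C: "C \<noteq> {}" "\<And>v. v \<in> C \<Longrightarrow> \<exists>a\<in>C. \<exists>b\<in>C. a \<noteq> b \<and>
      (a, v) \<in> arcs_ends (G \<restriction> S) \<and> (v, b) \<in> arcs_ends (G \<restriction> S)"
    by (rule pre_digraph.cycle_core) blast
  have sub: "(a, b) \<in> arcs_ends G \<and> a \<in> S \<and> b \<in> S \<and> a \<noteq> b"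
    if "(a, b) \<in> arcs_ends (G \<restriction> S)" for a b
    using that no_loops by (auto simp: arcs_ends_conv)
  have "C = {}"
  proof (rule assms)
    show "C \<subseteq> S" using C(2) sub by blast
  qed (use C(2) sub in metis)
  then show False using C(1) by simp
qed

lemma arcs_ends_sym: "(u, v) \<in> arcs_ends G \<longleftrightarrow> (v, u) \<in> arcs_ends G"
  using arcs_ends_symmetric[OF sym_arcs] by blast

lemma undirected_forest_triple:
  assumes "card S \<le> 3" "finite S" "x \<in> S" "y \<in> S" "x \<noteq> y" "(x, y) \<notin> arcs_ends G"
  shows "undirected_forest (G \<restriction> S)"
proof (rule undirected_forest_induceI)
  fix C assume CS: "C \<subseteq> S" and C: "\<And>v. v \<in> C \<Longrightarrow> \<exists>a\<in>C. \<exists>b\<in>C. a \<noteq> b \<and> a \<noteq> v \<and> b \<noteq> v \<and>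
      (a, v) \<in> arcs_ends G \<and> (v, b) \<in> arcs_ends G"
  have "card (S - {x, y}) \<le> Suc 0"
    using assms by (simp add: card_Diff_subset)
  then have "\<forall>v\<in>S - {x, y}. \<forall>w\<in>S - {x, y}. v = w"
    using card_le_Suc0_iff_eq[of "S - {x, y}"] assms(2) by blast
  then obtain z where z: "S \<subseteq> {x, y, z}"
    by (cases "S - {x, y} = {}") blast+
  have "x \<notin> C" using C[of x] CS z assms(6) arcs_ends_sym[of x y] by blast
  moreover have "y \<notin> C" using C[of y] CS z assms(6) arcs_ends_sym[of x y] by blast
  ultimately show "C = {}" using C CS z by blast
qed

text \<open>Within \<open>S\<close>, the only possible neighbour of \<open>b\<close> is
  \<open>d\<close>, and that of \<open>c\<close> is \<open>a\<close>. So neither lies in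
  \<open>C\<close>, and \<open>a\<close> and \<open>d\<close> alone cannot supply two neighbours
  each.\<close>

lemma undirected_forest_quadruple:
  assumes "S = {a, b, c, d}" "(a, b) \<notin> arcs_ends G" "(b, c) \<notin> arcs_ends G" "(c, d) \<notin> arcs_ends G"
  shows "undirected_forest (G \<restriction> S)"
proof (rule undirected_forest_induceI)
  fix C assume CS: "C \<subseteq> S" and C: "\<And>v. v \<in> C \<Longrightarrow> \<exists>a\<in>C. \<exists>b\<in>C. a \<noteq> b \<and> a \<noteq> v \<and> b \<noteq> v \<and>
      (a, v) \<in> arcs_ends G \<and> (v, b) \<in> arcs_ends G"
  have "b \<notin> C" using C[of b] CS assms arcs_ends_sym by blast
  moreover have "c \<notin> C" using C[of c] CS assms arcs_ends_sym by blast
  ultimately show "C = {}" using C CS assms by blast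
qed

section \<open>Degrees and matchings in the complement\<close>

lemma out_degree_eq_card_neighbours: "out_degree G v = card {w. (v, w) \<in> arcs_ends G}"
proof -
  have "bij_betw (head G) (out_arcs G v) {w. (v, w) \<in> arcs_ends G}"
    unfolding bij_betw_def inj_on_def
    using no_multi_arcs by (auto simp: arcs_ends_conv arc_to_ends_def)
  then show ?thesis unfolding out_degree_def by (rule bij_betw_same_card)
qed

text \<open>This is adjacency in the complement graph, but it also holds for elements outside
  \<open>verts G\<close>, so neighbourhoods are cut down to \<open>verts G\<close> when
  counted.\<close>

definition nonadjacent :: "'a \<Rightarrow> 'a \<Rightarrow> bool" where
  "nonadjacent u v \<longleftrightarrow> u \<noteq> v \<and> (u, v) \<notin> arcs_ends G"

lemma card_nonadjacent_ge:
  assumes "v \<in> verts G"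
  shows "card (verts G) \<le> max_degree G + 1 + card {w \<in> verts G. nonadjacent v w}"
proof -
  let ?N = "{w. (v, w) \<in> arcs_ends G}"
  have sub: "?N \<subseteq> verts G" by (auto dest: adj_in_verts)
  have "out_degree G v \<le> max_degree G"
    using assms unfolding max_degree_def by (intro Max_ge) auto
  then have N: "card ?N \<le> max_degree G" by (simp add: out_degree_eq_card_neighbours)
  have "verts G \<subseteq> insert v ?N \<union> {w \<in> verts G. nonadjacent v w}"
    by (auto simp: nonadjacent_def)
  then have "card (verts G) \<le> card (insert v ?N \<union> {w \<in> verts G. nonadjacent v w})"
    using sub by (intro card_mono) (auto intro: finite_subset)
  also have "\<dots> \<le> card (insert v ?N) + card {w \<in> verts G. nonadjacent v w}"
    by (rule card_Un_le)
  also have "card (insert v ?N) \<le> max_degree G + 1"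
    using N by (metis Suc_eq_plus1 Suc_le_mono card_insert_le_m1 card_insert_if finite_subset[OF sub] finite_verts le_SucI)
  finally show ?thesis by simp
qed

lemma ex_nonadjacent_matching:
  assumes "max_degree G + 1 + d \<le> card (verts G)" "2 * d \<le> card (verts G)"
  obtains P where "is_matching (verts G) nonadjacent d P"
proof -
  have "\<exists>P. is_matching (verts G) nonadjacent d P"
  proof (rule ex_matching)
    show "d \<le> card {w \<in> verts G. nonadjacent v w}" if "v \<in> verts G" for v
      using card_nonadjacent_ge[OF that] assms(1) by linarith
  qed (use assms arcs_ends_sym in \<open>auto simp: nonadjacent_def\<close>)
  then show thesis using that by blast
qed

section \<open>Equitable colourings grown from seeds\<close>

text \<open>\<open>P i\<close> is a seed and \<open>t i\<close> the final size of its class. The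
  extension gives no control over the added vertices, so the forest condition ranges over all
  supersets of that size.\<close>

lemma equitable_vertex_arboricity_leI:
  assumes "0 < k" "disjoint_family_on P {..<k}"
    and "\<And>i. i < k \<Longrightarrow> P i \<subseteq> verts G" "\<And>i. i < k \<Longrightarrow> card (P i) \<le> t i"
    and "(\<Sum>i<k. t i) = card (verts G)"
    and "\<And>i. i < k \<Longrightarrow> int (t i) = \<lceil>real (card (verts G)) / real k\<rceil> \<or>
      int (t i) = \<lfloor>real (card (verts G)) / real k\<rfloor>"
    and "\<And>i S. \<lbrakk>i < k; finite S; P i \<subseteq> S; card S = t i\<rbrakk> \<Longrightarrow> undirected_forest (G \<restriction> S)"
  shows "equitable_vertex_arboricity G \<le> k"
proof -
  obtain Q where Q: "disjoint_family_on Q {..<k}" "(\<Union>i<k. Q i) = verts G"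
    "\<forall>i<k. P i \<subseteq> Q i \<and> card (Q i) = t i"
    using ex_partition_extending[of "verts G" P k t] assms(2-5) by auto
  have "finite (Q i)" if "i < k" for i
    using Q(2) that finite_verts by (metis UN_upper finite_subset lessThan_iff)
  then have "equitable_tree_coloring G k Q"
    unfolding equitable_tree_coloring_def using Q assms(6,7) by auto
  then show ?thesis
    unfolding equitable_vertex_arboricity_def using assms(1) by (intro Least_le) blast
qed

lemma equitable_vertex_arboricity_le_triples:
  assumes "0 < k" "max_degree G + 1 + k \<le> card (verts G)"
    and "card (verts G) = 3 * k \<or> card (verts G) + 1 = 3 * k"
  shows "equitable_vertex_arboricity G \<le> k"
proof -
  obtain P where "is_matching (verts G) nonadjacent k P"
    by (rule ex_nonadjacent_matching[of k]) (use assms in auto)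
  then have disj: "disjoint_family_on P {..<k}"
    and edge: "\<And>i. i < k \<Longrightarrow> \<exists>x\<in>verts G. \<exists>y\<in>verts G. P i = {x, y} \<and> nonadjacent x y"
    by (auto simp: is_matching_def)
  \<comment> \<open>Class 0 alone absorbs the deficit: its size is 3 for \<open>3 * k\<close>
    vertices and 2 for \<open>3 * k - 1\<close>.\<close>
  define t :: "nat \<Rightarrow> nat" where "t i = (if i = 0 then card (verts G) + 3 - 3 * k else 3)" for i
  have t: "2 \<le> t i" "t i \<le> 3" for i using assms(1,3) unfolding t_def by auto
  show ?thesis
  proof (rule equitable_vertex_arboricity_leI)
    show "P i \<subseteq> verts G" "card (P i) \<le> t i" if "i < k" for i
      using edge[OF that] t(1)[of i] by (auto simp: card_insert_if)
    obtain l where l: "k = Suc l" using assms(1) gr0_conv_Suc by blast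
    show "(\<Sum>i<k. t i) = card (verts G)"
      unfolding l sum.lessThan_Suc_shift using assms(3) l by (auto simp: t_def)
    show "int (t i) = \<lceil>real (card (verts G)) / real k\<rceil> \<or>
      int (t i) = \<lfloor>real (card (verts G)) / real k\<rfloor>" if "i < k" for i
    proof (cases "card (verts G) = 3 * k")
      case True
      then show ?thesis using assms(1) by (simp add: t_def)
    next
      case False
      then have n: "real (card (verts G)) = 3 * real k - 1" using assms(3) by linarith
      show ?thesis
      proof (cases "i = 0")
        case True
        have "\<lfloor>real (card (verts G)) / real k\<rfloor> = 2"
          using assms(1) unfolding n by (auto simp: floor_eq_iff field_simps)
        then show ?thesis using True False assms(3) by (auto simp: t_def)
      next
        case False
        \<comment> \<open>The quotient is \<open>3 - 1 / k\<close>. A nonzero index below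
          \<open>k\<close> forces \<open>2 \<le> k\<close>; for \<open>k = 1\<close> the ceiling
          would be 2.\<close>
        then have "\<lceil>real (card (verts G)) / real k\<rceil> = 3"
          using that unfolding n by (auto simp: ceiling_eq_iff field_simps)
        then show ?thesis using False by (simp add: t_def)
      qed
    qed
    show "undirected_forest (G \<restriction> S)" if "i < k" "finite S" "P i \<subseteq> S" "card S = t i" for i S
      using edge[OF that(1)] that t(2)[of i] undirected_forest_triple[of S]
      by (auto simp: nonadjacent_def)
  qed (use assms disj in auto)
qed

lemma equitable_vertex_arboricity_le_quadruple:
  assumes "0 < k" "max_degree G + 1 = 2 * k" "card (verts G) = 3 * k + 1"
  shows "equitable_vertex_arboricity G \<le> k"
proof -
  \<comment> \<open>The complement has minimum degree at least
    \<open>3 * k + 1 - 2 * k = k + 1\<close>, and \<open>2 * (k + 1) \<le> 3 * k + 1\<close> since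
    \<open>0 < k\<close>.\<close>
  obtain M where M: "is_matching (verts G) nonadjacent (Suc k) M"
    by (rule ex_nonadjacent_matching[of "Suc k"]) (use assms in auto)
  then have disj: "disjoint_family_on M {..<Suc k}"
    and edge: "\<And>i. i < Suc k \<Longrightarrow> \<exists>x\<in>verts G. \<exists>y\<in>verts G. M i = {x, y} \<and> nonadjacent x y"
    by (auto simp: is_matching_def)
  have card2: "card (M i) = 2" if "i < Suc k" for i
    using edge[OF that] by (auto simp: nonadjacent_def)
  have "\<exists>j<Suc k. 0 < j \<and> (\<exists>x\<in>M 0. \<exists>y\<in>M j. nonadjacent x y)"
  proof (rule ccontr)
    assume no: "\<not> ?thesis"
    define U where "U = (\<Union>i<Suc k. M i)"
    have "U \<subseteq> verts G" using edge unfolding U_def by fastforce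
    have "finite (M i)" if "i < Suc k" for i using card2[OF that] card.infinite by fastforce
    then have "card U = (\<Sum>i<Suc k. card (M i))"
      unfolding U_def using disj
      by (intro card_UN_disjoint) (auto simp: disjoint_family_on_def)
    then have "card U = 2 * Suc k" using card2 by simp
    then have rest: "card (verts G - U) = k - 1"
      using \<open>U \<subseteq> verts G\<close> assms(3) by (simp add: card_Diff_subset finite_subset)
    obtain x y where xy: "x \<in> verts G" "M 0 = {x, y}" using edge[of 0] by auto
    \<comment> \<open>Without a complement edge from \<open>M 0\<close> to another matching edge,
      \<open>x\<close> has only \<open>y\<close> and the \<open>k - 1\<close> unmatched vertices as
      complement neighbours, fewer than \<open>k + 1\<close>.\<close>
    have "{w \<in> verts G. nonadjacent x w} \<subseteq> insert y (verts G - U)"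
    proof
      fix w assume w: "w \<in> {w \<in> verts G. nonadjacent x w}"
      have "w = y" if wU: "w \<in> U"
      proof -
        obtain j where "j < Suc k" "w \<in> M j" using wU unfolding U_def by auto
        then have "w \<in> M 0" using no w xy by (cases "j = 0") auto
        then show ?thesis using xy w by (auto simp: nonadjacent_def)
      qed
      then show "w \<in> insert y (verts G - U)" using w by auto
    qed
    then have "card {w \<in> verts G. nonadjacent x w} \<le> card (insert y (verts G - U))"
      by (intro card_mono) auto
    also have "\<dots> \<le> k" using rest assms(1) by (simp add: card_insert_if)
    finally show False using card_nonadjacent_ge[OF xy(1)] assms by linarith
  qed
  then obtain j x y where j: "j < Suc k" "0 < j" and xy: "x \<in> M 0" "y \<in> M j" "nonadjacent x y"
    by blast
  have sym: "nonadjacent u v \<longleftrightarrow> nonadjacent v u" for u v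
    using arcs_ends_sym by (auto simp: nonadjacent_def)
  have other: "\<exists>v. M i = {u, v} \<and> nonadjacent u v" if "i < Suc k" "u \<in> M i" for i u
    using edge[OF that(1)] that(2) sym by (metis doubleton_eq_iff insertE singletonD)
  \<comment> \<open>The partners are named so that \<open>x', x, y, y'\<close> is a path in the
    complement.\<close>
  obtain x' where x': "M 0 = {x, x'}" "nonadjacent x' x"
    using other[of 0 x] xy(1) sym by blast
  obtain y' where y': "M j = {y, y'}" "nonadjacent y y'"
    using other[OF j(1) xy(2)] by blast
  have MV: "M i \<subseteq> verts G" if "i < Suc k" for i using edge[OF that] by auto
  \<comment> \<open>Merging \<open>M j\<close> into class 0 vacates index \<open>j\<close>, which
    \<open>M k\<close> fills. If \<open>j = k\<close>, the second update only touches an index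
    outside the range.\<close>
  define P where "P = M(0 := M 0 \<union> M j, j := M k)"
  define t :: "nat \<Rightarrow> nat" where "t i = (if i = 0 then 4 else 3)" for i
  have disjD: "M a \<inter> M b = {}" if "a < Suc k" "b < Suc k" "a \<noteq> b" for a b
    using disj that by (auto simp: disjoint_family_on_def)
  have P0: "P 0 = M 0 \<union> M j" using j by (simp add: P_def)
  have cardP0: "card (P 0) = 4"
    unfolding P0 using card2[of 0] card2[of j] disjD[of 0 j] j
    by (subst card_Un_disjoint) (auto simp: card_ge_0_finite)
  have PS: "P i = M (if i = j then k else i)" if "i \<noteq> 0" for i
    using that j by (simp add: P_def)
  show ?thesis
  proof (rule equitable_vertex_arboricity_leI)
    show "disjoint_family_on P {..<k}"
      unfolding disjoint_family_on_def
    proof (intro ballI impI)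
      fix a b assume ab: "a \<in> {..<k}" "b \<in> {..<k}" "a \<noteq> b"
      have *: "P 0 \<inter> P i = {}" if "0 < i" "i < k" for i
        using that j disjD[of 0 "if i = j then k else i"] disjD[of j "if i = j then k else i"]
        unfolding P0 by (auto simp: PS)
      consider "a = 0" | "b = 0" | "a \<noteq> 0" "b \<noteq> 0" by blast
      then show "P a \<inter> P b = {}"
        using ab *[of a] *[of b] j
        by cases (auto simp: PS Int_commute disjD)
    qed
    show "P i \<subseteq> verts G" if "i < k" for i
      using that MV j by (cases "i = 0") (auto simp: P0 PS)
    show "card (P i) \<le> t i" if "i < k" for i
      using that cardP0 card2 by (cases "i = 0") (auto simp: PS t_def)
    obtain l where l: "k = Suc l" using assms(1) gr0_conv_Suc by blast
    show "(\<Sum>i<k. t i) = card (verts G)"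
      unfolding l sum.lessThan_Suc_shift using assms(3) l by (auto simp: t_def)
    have n: "real (card (verts G)) = 3 * real k + 1" using assms(3) by simp
    show "int (t i) = \<lceil>real (card (verts G)) / real k\<rceil> \<or>
      int (t i) = \<lfloor>real (card (verts G)) / real k\<rfloor>" if "i < k" for i
    proof (cases "i = 0")
      case True
      \<comment> \<open>The quotient is \<open>3 + 1 / k\<close>, with ceiling 4 for every positive
        \<open>k\<close>. The floor 3 in the other case needs \<open>2 \<le> k\<close>, which
        follows from \<open>0 < i < k\<close>.\<close>
      have "\<lceil>real (card (verts G)) / real k\<rceil> = 4"
        using assms(1) unfolding n by (auto simp: ceiling_eq_iff field_simps)
      then show ?thesis using True by (simp add: t_def)
    next
      case False
      then have "\<lfloor>real (card (verts G)) / real k\<rfloor> = 3"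
        using that unfolding n by (auto simp: floor_eq_iff field_simps)
      then show ?thesis using False by (simp add: t_def)
    qed
    show "undirected_forest (G \<restriction> S)" if S: "i < k" "finite S" "P i \<subseteq> S" "card S = t i" for i S
    proof (cases "i = 0")
      case True
      \<comment> \<open>The seed of class 0 already has its full size, so no vertex is
        added.\<close>
      then have "S = P 0" using S cardP0 card_subset_eq[of S "P 0"] by (auto simp: t_def)
      then have "S = {x', x, y, y'}" unfolding P0 x' y' by auto
      then show ?thesis
        using x'(2) xy(3) y'(2) by (intro undirected_forest_quadruple) (auto simp: nonadjacent_def)
    next
      case False
      define i' where "i' = (if i = j then k else i)"
      have "i' < Suc k" "M i' \<subseteq> S" using S False PS by (auto simp: i'_def)
      then show ?thesis
        using edge[of i'] S False undirected_forest_triple[of S]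
        by (auto simp: nonadjacent_def t_def)
    qed
  qed (use assms in auto)
qed

end

theorem theorem2p5:
  fixes G :: "('a, 'b) pre_digraph"
  assumes "graph G"
    and "2 / 3 * real (card (verts G)) - 1 > real (max_degree G)"
    and "real (max_degree G) \<ge> 2 / 3 * real (card (verts G)) - 2"
  shows "int (equitable_vertex_arboricity G) \<le> \<lceil>(real (max_degree G) + 1) / 2\<rceil>"
proof -
  interpret graph G by fact
  define n D where "n = card (verts G)" and "D = max_degree G"
  have n1: "3 * D + 3 < 2 * n" and n2: "2 * n \<le> 3 * D + 6"
    using assms(2,3) unfolding n_def D_def by linarith+
  define k where "k = D div 2 + 1"
  have "equitable_vertex_arboricity G \<le> k"
  proof (cases "even D")
    case True
    \<comment> \<open>The bounds become \<open>6 * k - 3 < 2 * n \<le> 6 * k\<close>, so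
      \<open>n\<close> is \<open>3 * k - 1\<close> or \<open>3 * k\<close>.\<close>
    then have "D + 2 = 2 * k" by (auto simp: k_def)
    then show ?thesis
      using n1 n2 by (intro equitable_vertex_arboricity_le_triples) (auto simp: n_def D_def)
  next
    case False
    \<comment> \<open>The bounds become \<open>6 * k < 2 * n \<le> 6 * k + 3\<close>, so
      \<open>n = 3 * k + 1\<close>.\<close>
    then have "D + 1 = 2 * k" by (auto simp: k_def elim: oddE)
    then show ?thesis
      using n1 n2 False
      by (intro equitable_vertex_arboricity_le_quadruple) (auto simp: n_def D_def)
  qed
  moreover have "int k \<le> \<lceil>(real D + 1) / 2\<rceil>"
    unfolding k_def le_ceiling_iff by (cases "even D") (auto elim!: evenE oddE)
  ultimately show ?thesis unfolding D_def by linarith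
qed

end
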